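(* Let $R>0$ and let $\overline{B}(0,R)=\{z\in\mathbb C:|z|\le R\}$. The map $z\mapsto B_z$ is continuous from $\overline{B}(0,R)$ into $\mathfrak F_{dist}(\mathbf 2)$, and there is a $p\in\mathbb N$ such that $B_z\in\mathcal F_{-p}$ for all $z\in\overline{B}(0,R)$ and $B_z$ is bounded in the norm of $\mathcal F_{-p}$ on $\overline{B}(0,R)$.
   Context: Hermite functions: $H_n(z)=(-1)^ne^{z^2}(d/dz)^ne^{-z^2}$ and $\zeta_n(z)=\frac{1}{\pi^{1/4}2^{n/2}(n!)^{1/2}}(-1)^ne^{-z^2/2}H_n(z)$, $n=0,1,\ldots$; these are entire functions, orthonormal in $L_2(\mathbb R,dx)$. For an entire function $h$, $\int_{[w,z]}h(u)\,du$ is the complex line integral along the segment from $w$ to $z$. White noise space: $\mathscr S'_{\mathbb R}$ is the space of real tempered distributions on $\mathbb R$, $\mathcal C$ its cylinder sigma-algebra, and $P$ the probability measure (Bochner–Minlos) with $\int e^{i\langle s,\omega\rangle}dP(\omega)=e^{-\|s\|_2^2/2}$ for all real Schwartz functions $s$. $Z_n(\omega)=\langle\zeta_n,\omega\rangle$, $n=0,1,\ldots$, are independent $N(0,1)$ random variables. Let $\ell$ be the set of finitely supported sequences $\alpha=(\alpha_1,\alpha_2,\ldots)$ of non-negative integers, with $\alpha!=\prod_k\alpha_k!$. The functions $H_\alpha=\prod_{k\ge1}h_{\alpha_k}(Z_{k-1})$, where $h_n(x)=(-1)^ne^{x^2/2}(d/dx)^ne^{-x^2/2}$, form an orthogonal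 basis of $\mathbf L_2(\mathscr S'_{\mathbb R},\mathcal C,P)$ with $\|H_\alpha\|^2=\alpha!$. Elements $\sum_\alpha f_\alpha H_\alpha$ are identified with their coefficient families $(f_\alpha)_{\alpha\in\ell}$; in particular $Z_n$ is identified with the family equal to $1$ at $\alpha^{(n)}$ and $0$ elsewhere, where $\alpha^{(n)}\in\ell$ has $1$ in position $n+1$ and $0$ elsewhere. Stochastic distributions: let $b_\alpha=\prod_{k\ge1}(2^k)^{\alpha_k}$. For $p=1,2,\ldots$, $\mathcal F_{-p}$ is the Hilbert space of complex families $(f_\alpha)_{\alpha\in\ell}$ with $\|f\|_{-p}^2=\sum_{\alpha\in\ell}|f_\alpha|^2b_\alpha^{-p}<\infty$, and $\mathfrak F_{dist}(\mathbf 2)=\bigcup_{p\ge1}\mathcal F_{-p}$ with the inductive limit topology. Complex Brownian motion: for $z\in\mathbb C$, $B_z=\sum_{n=0}^\infty\left(\int_{[0,z]}\zeta_n(u)\,du\right)Z_n$, i.e. the family with coefficient $\int_{[0,z]}\zeta_n(u)du$ at $\alpha^{(n)}$ ($n\ge0$) and $0$ at all other $\alpha\in\ell$. *)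

theory Defs
  imports "HOL-Complex_Analysis.Complex_Analysis" "HOL-Library.Poly_Mapping"
begin

definition hermite_fun :: "nat \<Rightarrow> complex \<Rightarrow> complex" where
  "hermite_fun n z = (-1) ^ n * exp (z\<^sup>2) * (deriv ^^ n) (\<lambda>u. exp (- (u\<^sup>2))) z"

definition zeta_fun :: "nat \<Rightarrow> complex \<Rightarrow> complex" where
  "zeta_fun n z =
     1 / of_real (pi powr (1/4) * 2 powr (real n / 2) * sqrt (fact n))
     * (-1) ^ n * exp (- (z\<^sup>2) / 2) * hermite_fun n z"

text \<open>Finitely supported multi-indices are indexed from 0 here: \<open>lookup \<alpha> k\<close> is the
  mathematical \<open>\<alpha>\<close> at position \<open>k + 1\<close>, which explains the exponent \<open>Suc k\<close> below.\<close>

type_synonym multi_index = "nat \<Rightarrow>\<^sub>0 nat"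
type_synonym family = "multi_index \<Rightarrow> complex"

definition weight :: "multi_index \<Rightarrow> real" where
  "weight \<alpha> = (\<Prod>k\<in>Poly_Mapping.keys \<alpha>. (2 ^ Suc k) ^ Poly_Mapping.lookup \<alpha> k)"

text \<open>\<open>F_minus p\<close> and \<open>norm_minus p\<close> are the Hilbert space with index \<open>-p\<close> and its norm;
  elements of the chaos expansion are identified with their coefficient families.
  \<open>norm_minus p f\<close> is only meaningful for \<open>f \<in> F_minus p\<close>.\<close>

definition F_minus :: "nat \<Rightarrow> family set" where
  "F_minus p = {f. (\<lambda>\<alpha>. (cmod (f \<alpha>))\<^sup>2 / weight \<alpha> ^ p) summable_on UNIV}"

definition norm_minus :: "nat \<Rightarrow> family \<Rightarrow> real" where
  "norm_minus p f = sqrt (\<Sum>\<^sub>\<infinity>\<alpha>. (cmod (f \<alpha>))\<^sup>2 / weight \<alpha> ^ p)"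

definition F_minus_topology :: "nat \<Rightarrow> family topology" where
  "F_minus_topology p =
     Metric_space.mtopology (F_minus p) (\<lambda>f g. norm_minus p (\<lambda>\<alpha>. f \<alpha> - g \<alpha>))"

definition F_dist :: "family set" where
  "F_dist = (\<Union>p\<in>{1..}. F_minus p)"

definition locally_convex_topology ::
    "('i \<Rightarrow> complex) set \<Rightarrow> ('i \<Rightarrow> complex) topology \<Rightarrow> bool" where
  "locally_convex_topology E T \<longleftrightarrow>
     topspace T = E \<and>
     continuous_map (prod_topology T T) T (\<lambda>(f, g). (\<lambda>i. f i + g i)) \<and>
     continuous_map (prod_topology euclidean T) T (\<lambda>(c, f). (\<lambda>i. c * f i)) \<and>
     (\<forall>U. openin T U \<and> (\<lambda>i. 0) \<in> U \<longrightarrow>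
        (\<exists>V. openin T V \<and> (\<lambda>i. 0) \<in> V \<and> V \<subseteq> U \<and>
           (\<forall>f\<in>V. \<forall>g\<in>V. \<forall>t\<in>{0..1::real}.
              (\<lambda>i. of_real (1 - t) * f i + of_real t * g i) \<in> V)))"

text \<open>The inductive limit topology is the finest locally convex vector topology for which all
  inclusions of the spaces \<open>F_minus p\<close> are continuous. It is written as the supremum of all
  topologies with this property; the lemmas at the end show that the supremum has the property
  itself.\<close>

definition F_dist_compatible :: "family topology \<Rightarrow> bool" where
  "F_dist_compatible T \<longleftrightarrow>
     locally_convex_topology F_dist T \<and>
     (\<forall>p\<ge>1. continuous_map (F_minus_topology p) T (\<lambda>f. f))"

definition F_dist_topology :: "family topology" where
  "F_dist_topology = topology_generated_by {U. \<exists>T. F_dist_compatible T \<and> openin T U}"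

text \<open>The multi-index \<open>Poly_Mapping.single n 1\<close> is the one of the Gaussian variable
  \<open>Z\<^sub>n\<close>, so this is the coefficient family of the sum over \<open>n\<close> of
  \<open>contour_integral (linepath 0 z) (zeta_fun n)\<close> times \<open>Z\<^sub>n\<close>; see \<open>brownian_single\<close>.\<close>

definition brownian :: "complex \<Rightarrow> family" where
  "brownian z = (\<lambda>\<alpha>. if \<exists>n. \<alpha> = Poly_Mapping.single n 1
     then contour_integral (linepath 0 z) (zeta_fun (THE n. \<alpha> = Poly_Mapping.single n 1))
     else 0)"

lemma brownian_single:
  "brownian z (Poly_Mapping.single n 1) = contour_integral (linepath 0 z) (zeta_fun n)"
proof -
  have "(THE m. Poly_Mapping.single n (1::nat) = Poly_Mapping.single m 1) = n"
  proof (rule the_equality)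
    fix m assume eq: "Poly_Mapping.single n (1::nat) = Poly_Mapping.single m 1"
    have "Poly_Mapping.keys (Poly_Mapping.single n (1::nat))
        = Poly_Mapping.keys (Poly_Mapping.single m (1::nat))"
      by (simp only: eq)
    then show "m = n" by simp
  qed simp
  then show ?thesis by (auto simp: brownian_def)
qed

lemma weight_pos: "weight \<alpha> > 0"
  unfolding weight_def by (intro prod_pos) simp

lemma weighted_term:
  "(cmod (f \<alpha>))\<^sup>2 / weight \<alpha> ^ p = (cmod (f \<alpha>) / sqrt (weight \<alpha> ^ p))\<^sup>2"
  using weight_pos[of \<alpha>] by (simp add: power_divide)

lemma F_minus_bound:
  assumes "\<And>A. finite A \<Longrightarrow> L2_set (\<lambda>\<alpha>. cmod (f \<alpha>) / sqrt (weight \<alpha> ^ p)) A \<le> C"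
  shows "f \<in> F_minus p" "norm_minus p f \<le> C"
proof -
  have C: "C \<ge> 0" using assms[of "{}"] by simp
  have le: "(\<Sum>\<alpha>\<in>A. (cmod (f \<alpha>))\<^sup>2 / weight \<alpha> ^ p) \<le> C\<^sup>2" if "finite A" for A
  proof -
    have "sqrt (\<Sum>\<alpha>\<in>A. (cmod (f \<alpha>))\<^sup>2 / weight \<alpha> ^ p) \<le> C"
      using assms[OF that] unfolding L2_set_def weighted_term .
    then show ?thesis using C by (simp add: sqrt_le_D)
  qed
  have S: "(\<lambda>\<alpha>. (cmod (f \<alpha>))\<^sup>2 / weight \<alpha> ^ p) summable_on UNIV"
  proof (rule nonneg_bdd_above_summable_on)
    show "bdd_above (sum (\<lambda>\<alpha>. (cmod (f \<alpha>))\<^sup>2 / weight \<alpha> ^ p) ` {F. F \<subseteq> UNIV \<and> finite F})"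
      by (rule bdd_aboveI2[of _ _ "C\<^sup>2"]) (use le in auto)
  qed (use weight_pos in \<open>simp add: less_imp_le\<close>)
  then show "f \<in> F_minus p" by (simp add: F_minus_def)
  have "(\<Sum>\<^sub>\<infinity>\<alpha>. (cmod (f \<alpha>))\<^sup>2 / weight \<alpha> ^ p) \<le> C\<^sup>2"
    by (rule infsum_le_finite_sums[OF S]) (use le in auto)
  then show "norm_minus p f \<le> C"
    unfolding norm_minus_def using C by (simp add: real_le_lsqrt)
qed

lemma L2_set_le_norm_minus:
  assumes "f \<in> F_minus p" "finite A"
  shows "L2_set (\<lambda>\<alpha>. cmod (f \<alpha>) / sqrt (weight \<alpha> ^ p)) A \<le> norm_minus p f"
proof -
  have "(\<Sum>\<alpha>\<in>A. (cmod (f \<alpha>))\<^sup>2 / weight \<alpha> ^ p) \<le> (\<Sum>\<^sub>\<infinity>\<alpha>. (cmod (f \<alpha>))\<^sup>2 / weight \<alpha> ^ p)"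
    using assms weight_pos
    by (intro finite_sum_le_infsum) (auto simp: F_minus_def less_imp_le)
  then show ?thesis
    unfolding L2_set_def norm_minus_def weighted_term[symmetric] by simp
qed

lemma norm_minus_triangle:
  assumes "f \<in> F_minus p" "g \<in> F_minus p"
    and h: "\<And>\<alpha>. cmod (h \<alpha>) \<le> cmod (f \<alpha>) + cmod (g \<alpha>)"
  shows "h \<in> F_minus p" "norm_minus p h \<le> norm_minus p f + norm_minus p g"
proof -
  have "L2_set (\<lambda>\<alpha>. cmod (h \<alpha>) / sqrt (weight \<alpha> ^ p)) A \<le> norm_minus p f + norm_minus p g"
    if "finite A" for A
  proof -
    have "L2_set (\<lambda>\<alpha>. cmod (h \<alpha>) / sqrt (weight \<alpha> ^ p)) A
        \<le> L2_set (\<lambda>\<alpha>. cmod (f \<alpha>) / sqrt (weight \<alpha> ^ p) + cmod (g \<alpha>) / sqrt (weight \<alpha> ^ p)) A"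
    proof (rule L2_set_mono)
      fix \<alpha>
      show "cmod (h \<alpha>) / sqrt (weight \<alpha> ^ p)
          \<le> cmod (f \<alpha>) / sqrt (weight \<alpha> ^ p) + cmod (g \<alpha>) / sqrt (weight \<alpha> ^ p)"
        using h[of \<alpha>] weight_pos[of \<alpha>]
        by (simp add: add_divide_distrib[symmetric] divide_right_mono)
      show "0 \<le> cmod (h \<alpha>) / sqrt (weight \<alpha> ^ p)"
        using weight_pos[of \<alpha>] by simp
    qed
    also have "\<dots> \<le> L2_set (\<lambda>\<alpha>. cmod (f \<alpha>) / sqrt (weight \<alpha> ^ p)) A
        + L2_set (\<lambda>\<alpha>. cmod (g \<alpha>) / sqrt (weight \<alpha> ^ p)) A"
      by (rule L2_set_triangle_ineq)
    also have "\<dots> \<le> norm_minus p f + norm_minus p g"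
      using assms that by (intro add_mono L2_set_le_norm_minus)
    finally show ?thesis .
  qed
  note bound = this
  show "h \<in> F_minus p" "norm_minus p h \<le> norm_minus p f + norm_minus p g"
    by (rule F_minus_bound, erule bound)+
qed

lemma norm_minus_eq_0:
  assumes "f \<in> F_minus p"
  shows "norm_minus p f = 0 \<longleftrightarrow> f = (\<lambda>\<alpha>. 0)"
proof
  assume "norm_minus p f = 0"
  show "f = (\<lambda>\<alpha>. 0)"
  proof
    fix \<alpha>
    have "sqrt (weight \<alpha> ^ p) > 0" using weight_pos[of \<alpha>] by simp
    moreover have "cmod (f \<alpha>) / sqrt (weight \<alpha> ^ p) \<le> 0"
      using L2_set_le_norm_minus[OF assms, of "{\<alpha>}"] \<open>norm_minus p f = 0\<close> weight_pos[of \<alpha>]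
      unfolding L2_set_def by auto
    ultimately have "cmod (f \<alpha>) \<le> 0" by (metis divide_pos_pos not_le)
    then show "f \<alpha> = 0" by simp
  qed
qed (simp add: norm_minus_def)

lemma Metric_space_F_minus:
  "Metric_space (F_minus p) (\<lambda>f g. norm_minus p (\<lambda>\<alpha>. f \<alpha> - g \<alpha>))"
proof
  fix f g h
  show "0 \<le> norm_minus p (\<lambda>\<alpha>. f \<alpha> - g \<alpha>)"
    unfolding norm_minus_def using weight_pos
    by (auto intro!: real_sqrt_ge_zero infsum_nonneg simp: less_imp_le)
  show "norm_minus p (\<lambda>\<alpha>. f \<alpha> - g \<alpha>) = norm_minus p (\<lambda>\<alpha>. g \<alpha> - f \<alpha>)"
    by (simp add: norm_minus_def norm_minus_commute)
  assume fg: "f \<in> F_minus p" "g \<in> F_minus p"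
  have "(\<lambda>\<alpha>. f \<alpha> - g \<alpha>) \<in> F_minus p"
    by (rule norm_minus_triangle(1)[OF fg]) (rule norm_triangle_ineq4)
  then have "norm_minus p (\<lambda>\<alpha>. f \<alpha> - g \<alpha>) = 0 \<longleftrightarrow> (\<lambda>\<alpha>. f \<alpha> - g \<alpha>) = (\<lambda>\<alpha>. 0)"
    by (rule norm_minus_eq_0)
  then show "norm_minus p (\<lambda>\<alpha>. f \<alpha> - g \<alpha>) = 0 \<longleftrightarrow> f = g"
    by (simp add: fun_eq_iff)
  assume h: "h \<in> F_minus p"
  have sub: "(\<lambda>\<alpha>. u \<alpha> - v \<alpha>) \<in> F_minus p" if "u \<in> F_minus p" "v \<in> F_minus p" for u v
    by (rule norm_minus_triangle(1)[OF that]) (rule norm_triangle_ineq4)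
  show "norm_minus p (\<lambda>\<alpha>. f \<alpha> - h \<alpha>)
      \<le> norm_minus p (\<lambda>\<alpha>. f \<alpha> - g \<alpha>) + norm_minus p (\<lambda>\<alpha>. g \<alpha> - h \<alpha>)"
    by (rule norm_minus_triangle(2)[OF sub[OF fg] sub[OF fg(2) h]])
      (metis diff_add_cancel diff_add_eq_diff_diff_swap norm_triangle_ineq add_diff_eq add.commute)
qed

lemma topspace_F_minus_topology [simp]: "topspace (F_minus_topology p) = F_minus p"
  unfolding F_minus_topology_def
  by (rule Metric_space.topspace_mtopology[OF Metric_space_F_minus])

lemma F_minus_mono:
  assumes "p \<le> q"
  shows "F_minus p \<subseteq> F_minus q"
proof
  fix f assume f: "f \<in> F_minus p"
  have w1: "weight \<alpha> \<ge> 1" for \<alpha>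
    unfolding weight_def by (intro prod_ge_1 one_le_power) simp
  show "f \<in> F_minus q"
  proof (rule F_minus_bound(1))
    fix A :: "multi_index set" assume "finite A"
    have "L2_set (\<lambda>\<alpha>. cmod (f \<alpha>) / sqrt (weight \<alpha> ^ q)) A
        \<le> L2_set (\<lambda>\<alpha>. cmod (f \<alpha>) / sqrt (weight \<alpha> ^ p)) A"
    proof (rule L2_set_mono)
      fix \<alpha>
      show "cmod (f \<alpha>) / sqrt (weight \<alpha> ^ q) \<le> cmod (f \<alpha>) / sqrt (weight \<alpha> ^ p)"
        using w1 weight_pos assms by (intro divide_left_mono) (auto intro: power_increasing)
      show "0 \<le> cmod (f \<alpha>) / sqrt (weight \<alpha> ^ q)"
        using weight_pos[of \<alpha>] by simp
    qed
    also have "\<dots> \<le> norm_minus p f"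
      using f \<open>finite A\<close> by (rule L2_set_le_norm_minus)
    finally show "L2_set (\<lambda>\<alpha>. cmod (f \<alpha>) / sqrt (weight \<alpha> ^ q)) A \<le> norm_minus p f" .
  qed
qed

lemma F_minus_scale:
  assumes "f \<in> F_minus p"
  shows "(\<lambda>\<alpha>. c * f \<alpha>) \<in> F_minus p"
  using assms summable_on_cmult_right[of "\<lambda>\<alpha>. (cmod (f \<alpha>))\<^sup>2 / weight \<alpha> ^ p" UNIV "(cmod c)\<^sup>2"]
  by (simp add: F_minus_def norm_mult power_mult_distrib)

lemma F_dist_add:
  assumes "f \<in> F_dist" "g \<in> F_dist"
  shows "(\<lambda>\<alpha>. f \<alpha> + g \<alpha>) \<in> F_dist"
proof -
  obtain p q where p: "p \<ge> 1" "f \<in> F_minus p" and q: "q \<ge> 1" "g \<in> F_minus q"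
    using assms by (auto simp: F_dist_def)
  then have "f \<in> F_minus (max p q)" "g \<in> F_minus (max p q)"
    using F_minus_mono[of p "max p q"] F_minus_mono[of q "max p q"] by auto
  then have "(\<lambda>\<alpha>. f \<alpha> + g \<alpha>) \<in> F_minus (max p q)"
    by (rule norm_minus_triangle(1)) (rule norm_triangle_ineq)
  then show ?thesis
    using p(1) unfolding F_dist_def by (intro UN_I[of "max p q"]) auto
qed

lemma F_dist_scale: "f \<in> F_dist \<Longrightarrow> (\<lambda>\<alpha>. c * f \<alpha>) \<in> F_dist"
  unfolding F_dist_def by (auto intro: F_minus_scale)

lemma F_dist_compatible_indiscrete:
  "F_dist_compatible (topology_generated_by {F_dist})"
proof -
  let ?T = "topology_generated_by {F_dist}"
  have cont: "continuous_map X ?T f" if "f ` topspace X \<subseteq> F_dist" for X :: "'x topology" and f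
  proof (rule continuous_on_generated_topo)
    fix U assume "U \<in> {F_dist}"
    then have "f -` U \<inter> topspace X = topspace X" using that by auto
    then show "openin X (f -` U \<inter> topspace X)" by simp
  qed (use that in auto)
  have cl: "U = {} \<or> U = F_dist" if "openin ?T U" for U
    using openin_topology_generated_by[OF that]
    by (induction rule: generate_topology_on.induct) auto
  have op: "openin ?T F_dist" by (rule topology_generated_by_Basis) simp
  show ?thesis
    unfolding F_dist_compatible_def locally_convex_topology_def
  proof (intro conjI allI impI)
    fix U assume "openin ?T U \<and> (\<lambda>i. 0) \<in> U"
    then have U: "U = F_dist" "(\<lambda>i. 0) \<in> F_dist" using cl[of U] by auto
    show "\<exists>V. openin ?T V \<and> (\<lambda>i. 0) \<in> V \<and> V \<subseteq> U \<and>
           (\<forall>f\<in>V. \<forall>g\<in>V. \<forall>t\<in>{0..1::real}.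
              (\<lambda>i. of_real (1 - t) * f i + of_real t * g i) \<in> V)"
      using U op by (intro exI[of _ F_dist]) (auto intro!: F_dist_add F_dist_scale)
  next
    show "topspace ?T = F_dist" by simp
    show "continuous_map (prod_topology ?T ?T) ?T (\<lambda>(f, g). (\<lambda>i. f i + g i))"
      by (rule cont) (auto intro: F_dist_add)
    show "continuous_map (prod_topology euclidean ?T) ?T (\<lambda>(c, f). (\<lambda>i. c * f i))"
      by (rule cont) (auto intro: F_dist_scale)
  next
    fix p :: nat assume "1 \<le> p"
    then show "continuous_map (F_minus_topology p) ?T (\<lambda>f. f)"
      by (intro cont) (auto simp: F_dist_def)
  qed
qed

lemma topspace_F_dist_topology [simp]: "topspace F_dist_topology = F_dist"
proof
  show "topspace F_dist_topology \<subseteq> F_dist"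
    unfolding F_dist_topology_def F_dist_compatible_def locally_convex_topology_def
    using openin_subset by fastforce
  show "F_dist \<subseteq> topspace F_dist_topology"
    unfolding F_dist_topology_def
    using F_dist_compatible_indiscrete topology_generated_by_Basis[of F_dist "{F_dist}"] by auto
qed

text \<open>Universal property of the supremum.\<close>

lemma continuous_map_F_dist_topology_iff:
  "continuous_map X F_dist_topology f \<longleftrightarrow> (\<forall>T. F_dist_compatible T \<longrightarrow> continuous_map X T f)"
proof
  assume f: "continuous_map X F_dist_topology f"
  show "\<forall>T. F_dist_compatible T \<longrightarrow> continuous_map X T f"
  proof (intro allI impI)
    fix T assume T: "F_dist_compatible T"
    then have top: "topspace T = F_dist"
      by (simp add: F_dist_compatible_def locally_convex_topology_def)
    have "openin F_dist_topology U" if "openin T U" for U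
      unfolding F_dist_topology_def using T that by (intro topology_generated_by_Basis) auto
    then show "continuous_map X T f"
      using f top by (auto simp: continuous_map_alt)
  qed
next
  assume f: "\<forall>T. F_dist_compatible T \<longrightarrow> continuous_map X T f"
  then have "continuous_map X (topology_generated_by {F_dist}) f"
    using F_dist_compatible_indiscrete by blast
  then have "f ` topspace X \<subseteq> F_dist"
    by (auto simp: continuous_map_def Pi_iff)
  then show "continuous_map X F_dist_topology f"
    using f topspace_F_dist_topology unfolding F_dist_topology_def
    by (intro continuous_on_generated_topo) (auto simp: continuous_map_alt)
qed

lemma F_dist_topology_finer:
  assumes "F_dist_compatible T" "openin T U"
  shows "openin F_dist_topology U"
  unfolding F_dist_topology_def using assms by (intro topology_generated_by_Basis) auto

text \<open>The supremum is itself locally convex with continuous inclusions, hence the finest such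
  topology.\<close>

lemma F_dist_compatible_F_dist_topology: "F_dist_compatible F_dist_topology"
proof -
  have id: "continuous_map F_dist_topology T (\<lambda>f. f)" if "F_dist_compatible T" for T
    using that continuous_map_F_dist_topology_iff[of F_dist_topology "\<lambda>f. f"]
    by (simp add: continuous_map_id[unfolded id_def])
  have add: "continuous_map (prod_topology F_dist_topology F_dist_topology) T
      (\<lambda>(f, g). (\<lambda>i. f i + g i))" if T: "F_dist_compatible T" for T
  proof -
    have "continuous_map (prod_topology F_dist_topology F_dist_topology) (prod_topology T T)
        (\<lambda>(f, g). (f, g))"
      by (rule continuous_map_prod_top[THEN iffD2]) (use id[OF T] in blast)
    moreover have "continuous_map (prod_topology T T) T (\<lambda>(f, g). (\<lambda>i. f i + g i))"
      using T by (simp add: F_dist_compatible_def locally_convex_topology_def)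
    ultimately have "continuous_map (prod_topology F_dist_topology F_dist_topology) T
        ((\<lambda>(f, g). (\<lambda>i. f i + g i)) \<circ> (\<lambda>(f, g). (f, g)))"
      by (rule continuous_map_compose)
    then show ?thesis by (simp add: o_def split_def)
  qed
  have scale: "continuous_map (prod_topology euclidean F_dist_topology) T
      (\<lambda>(c, f). (\<lambda>i. c * f i))" if T: "F_dist_compatible T" for T
  proof -
    have "continuous_map (prod_topology euclidean F_dist_topology) (prod_topology euclidean T)
        (\<lambda>(c::complex, f). (c, f))"
      by (rule continuous_map_prod_top[THEN iffD2])
        (use id[OF T] continuous_map_id[of "euclidean :: complex topology", unfolded id_def] in blast)
    moreover have "continuous_map (prod_topology euclidean T) T (\<lambda>(c, f). (\<lambda>i. c * f i))"
      using T by (simp add: F_dist_compatible_def locally_convex_topology_def)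
    ultimately have "continuous_map (prod_topology euclidean F_dist_topology) T
        ((\<lambda>(c, f). (\<lambda>i. c * f i)) \<circ> (\<lambda>(c, f). (c, f)))"
      by (rule continuous_map_compose)
    then show ?thesis by (simp add: o_def split_def)
  qed
  define conv where "conv V \<longleftrightarrow> (\<forall>f\<in>V. \<forall>g\<in>V. \<forall>t\<in>{0..1::real}.
      (\<lambda>i. of_real (1 - t) * f i + of_real t * g i) \<in> V)" for V :: "family set"
  have conv_Int: "conv (V \<inter> W)" if "conv V" "conv W" for V W
    using that unfolding conv_def by blast
  have lc: "\<exists>V. openin F_dist_topology V \<and> (\<lambda>i. 0) \<in> V \<and> V \<subseteq> U \<and> conv V"
    if "openin F_dist_topology U" "(\<lambda>i. 0) \<in> U" for U
    using openin_topology_generated_by[OF that(1)[unfolded F_dist_topology_def]] that(2)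
  proof (induction rule: generate_topology_on.induct)
    case Empty
    then show ?case by simp
  next
    case (Int a b)
    obtain V where "openin F_dist_topology V" "(\<lambda>i. 0) \<in> V" "V \<subseteq> a" "conv V"
      using Int by blast
    moreover obtain W where "openin F_dist_topology W" "(\<lambda>i. 0) \<in> W" "W \<subseteq> b" "conv W"
      using Int by blast
    ultimately show ?case
      by (intro exI[of _ "V \<inter> W"] conjI conv_Int openin_Int) auto
  next
    case (UN K)
    then obtain k where k: "k \<in> K" "(\<lambda>i. 0) \<in> k" by blast
    with UN.IH[OF k] show ?case by (meson Union_upper subset_trans)
  next
    case (Basis U)
    then obtain T where T: "F_dist_compatible T" "openin T U" by blast
    then obtain V where "openin T V" "(\<lambda>i. 0) \<in> V" "V \<subseteq> U" "conv V"
      using Basis(2) unfolding F_dist_compatible_def locally_convex_topology_def conv_def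
      by meson
    then show ?case using F_dist_topology_finer[OF T(1)] by blast
  qed
  have incl: "continuous_map (F_minus_topology p) F_dist_topology (\<lambda>f. f)" if "p \<ge> 1" for p
    using that by (simp add: continuous_map_F_dist_topology_iff F_dist_compatible_def)
  have "locally_convex_topology F_dist F_dist_topology"
    unfolding locally_convex_topology_def continuous_map_F_dist_topology_iff
    using add scale lc[unfolded conv_def]
    by (intro conjI allI impI) (simp_all only: topspace_F_dist_topology)
  then show ?thesis
    unfolding F_dist_compatible_def using incl by blast
qed

end

theory Submission
  imports Defs
begin

text \<open>Cauchy's inequality for \<open>exp (- u\<^sup>2)\<close> on the circle of radius \<open>sqrt (n + 1)\<close> around \<open>z\<close>
  shows that \<open>zeta_fun n\<close> grows at most geometrically in \<open>n\<close>, uniformly on a ball. The weight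
  of the \<open>n\<close>-th first-order multi-index is \<open>2 ^ (n + 1)\<close>, so a fixed power of it absorbs this
  growth, and \<open>brownian\<close> is Lipschitz on the ball with respect to the corresponding norm.\<close>

lemma gaussian_higher_deriv_bound:
  fixes z :: complex
  assumes "cmod z \<le> R"
  shows "cmod ((deriv ^^ n) (\<lambda>u. exp (- (u\<^sup>2))) z) \<le> sqrt (fact n) * exp (2 * R\<^sup>2 + 2 * (real n + 1))"
proof -
  \<comment> \<open>This radius balances two costs: the Gaussian on the circle grows like
    \<open>exp (2 * s^2)\<close>, only geometric in \<open>n\<close>, while dividing by
    \<open>s ^ n\<close> removes half of the factorial.\<close>
  define s where "s = sqrt (real n + 1)"
  have s: "s > 0" "s\<^sup>2 = real n + 1" unfolding s_def by simp_all
  have bound: "cmod (exp (- (u\<^sup>2))) \<le> exp (2 * R\<^sup>2 + 2 * (real n + 1))"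
    if "cmod (z - u) = s" for u
  proof -
    have "cmod u \<le> R + s"
      using norm_triangle_ineq4[of z "z - u"] that assms by simp
    then have "(cmod u)\<^sup>2 \<le> (R + s)\<^sup>2" by (simp add: power_mono)
    also have "\<dots> \<le> 2 * R\<^sup>2 + 2 * s\<^sup>2"
      using sum_squares_bound[of R s] by (simp add: power2_sum)
    finally have "cmod (u\<^sup>2) \<le> 2 * R\<^sup>2 + 2 * (real n + 1)" by (simp add: norm_power s)
    then show ?thesis
      using complex_Re_le_cmod[of "- (u\<^sup>2)"] by (simp add: norm_exp_eq_Re)
  qed
  have "cmod ((deriv ^^ n) (\<lambda>u. exp (- (u\<^sup>2))) z)
      \<le> fact n * exp (2 * R\<^sup>2 + 2 * (real n + 1)) / s ^ n"
    by (rule Cauchy_inequality) (use s bound in \<open>auto intro!: holomorphic_intros continuous_intros\<close>)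
  also have "\<dots> \<le> sqrt (fact n) * exp (2 * R\<^sup>2 + 2 * (real n + 1))"
  proof -
    \<comment> \<open>Since \<open>s^2 = n + 1\<close>, the chain
      \<open>fact n \<le> n ^ n \<le> (n + 1) ^ n\<close> bounds \<open>fact n\<close> by the square
      of \<open>s ^ n\<close>; hence \<open>fact n / s ^ n \<le> sqrt (fact n)\<close>.\<close>
    have "(fact n :: real) \<le> real n ^ n" using fact_le_power[of n, where 'a = real] by simp
    also have "\<dots> \<le> (real n + 1) ^ n" by (intro power_mono) auto
    finally have "sqrt (fact n) \<le> s ^ n"
      unfolding s_def by (simp add: real_sqrt_power[symmetric])
    then have "sqrt (fact n) * sqrt (fact n) \<le> sqrt (fact n) * s ^ n"
      by (intro mult_left_mono) auto
    then have "fact n \<le> sqrt (fact n) * s ^ n" by simp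
    then have "fact n * exp (2 * R\<^sup>2 + 2 * (real n + 1))
        \<le> sqrt (fact n) * s ^ n * exp (2 * R\<^sup>2 + 2 * (real n + 1))"
      by (intro mult_right_mono) auto
    then show ?thesis using s(1) by (simp add: divide_le_eq mult_ac)
  qed
  finally show ?thesis .
qed

text \<open>The \<open>sqrt (fact n)\<close> from the derivative bound cancels the one in the
  normalisation, leaving \<open>exp 2 ^ Suc n\<close>. Rounding \<open>exp 2\<close> up to 16, a
  power of 2, makes the growth directly comparable with the weights.\<close>

lemma zeta_fun_bound:
  assumes "cmod z \<le> R"
  shows "cmod (zeta_fun n z) \<le> exp (4 * R\<^sup>2) * 16 ^ Suc n"
proof -
  define D where "D = cmod ((deriv ^^ n) (\<lambda>u. exp (- (u\<^sup>2))) z)"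
  define c where "c = pi powr (1/4) * 2 powr (real n / 2)"
  \<comment> \<open>The rest of the normalising constant only helps: it is at least 1 and is
    estimated away below.\<close>
  have c: "c \<ge> 1"
    unfolding c_def using pi_gt3 mult_mono[of 1 "pi powr (1/4)" 1 "2 powr (real n / 2)"]
    by (simp add: ge_one_powr_ge_zero)
  have R: "0 \<le> R" using assms norm_ge_zero order_trans by blast
  have "cmod (exp (- (z\<^sup>2) / 2)) * cmod (exp (z\<^sup>2)) = exp (Re (z\<^sup>2) / 2)"
    by (simp add: norm_exp_eq_Re exp_add[symmetric])
  also have "\<dots> \<le> exp (R\<^sup>2 / 2)"
    using complex_Re_le_cmod[of "z\<^sup>2"] power_mono[OF assms, of 2] by (simp add: norm_power)
  finally have e: "cmod (exp (- (z\<^sup>2) / 2)) * cmod (exp (z\<^sup>2)) \<le> exp (R\<^sup>2 / 2)" .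
  have "cmod (zeta_fun n z)
      = 1 / (c * sqrt (fact n)) * (cmod (exp (- (z\<^sup>2) / 2)) * cmod (exp (z\<^sup>2))) * D"
    unfolding zeta_fun_def hermite_fun_def c_def D_def
    by (simp add: norm_mult norm_divide norm_power del: norm_exp_eq_Re)
  also have "\<dots> \<le> 1 / (1 * sqrt (fact n)) * exp (R\<^sup>2 / 2)
      * (sqrt (fact n) * exp (2 * R\<^sup>2 + 2 * (real n + 1)))"
    using c e gaussian_higher_deriv_bound[OF assms, of n] unfolding D_def
    by (intro mult_mono divide_left_mono) auto
  also have "\<dots> = exp (R\<^sup>2 / 2 + 2 * R\<^sup>2) * exp 2 ^ Suc n"
    unfolding exp_of_nat_mult[symmetric] by (simp add: field_simps flip: exp_add)
  also have "\<dots> \<le> exp (4 * R\<^sup>2) * 16 ^ Suc n"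
  proof (intro mult_mono power_mono)
    have "exp (2::real) = exp 1 * exp 1" by (simp add: exp_add[symmetric])
    also have "\<dots> \<le> 3 * 3" using exp_le by (intro mult_mono) auto
    finally show "exp (2::real) \<le> 16" by simp
  qed auto
  finally show ?thesis .
qed

lemma holomorphic_zeta_fun: "zeta_fun n holomorphic_on S"
  unfolding zeta_fun_def hermite_fun_def
  \<comment> \<open>Higher derivatives are holomorphic on an open set, so the claim is proved on the
    whole plane and then restricted to \<open>S\<close>.\<close>
  by (rule holomorphic_on_subset[of _ UNIV])
    (auto intro!: holomorphic_intros holomorphic_higher_deriv)

text \<open>Being entire, \<open>zeta_fun n\<close> has a primitive \<open>F\<close>, so the two
  segment integrals from 0 differ by \<open>F z - F w\<close>. The mean value inequality on the
  convex ball then turns the bound on \<open>zeta_fun n\<close> into a Lipschitz estimate.\<close>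

lemma brownian_single_diff:
  assumes "cmod z \<le> R" "cmod w \<le> R"
  shows "cmod (brownian z (Poly_Mapping.single n 1) - brownian w (Poly_Mapping.single n 1))
    \<le> exp (4 * R\<^sup>2) * cmod (z - w) * 16 ^ Suc n"
proof -
  obtain F where F: "\<And>x. (F has_field_derivative zeta_fun n x) (at x)"
    using holomorphic_convex_primitive'[of UNIV "zeta_fun n"] holomorphic_zeta_fun by auto
  have int: "contour_integral (linepath 0 x) (zeta_fun n) = F x - F 0" for x
    using contour_integral_unique[OF contour_integral_primitive[of UNIV F "zeta_fun n" "linepath 0 x"]] F
    by simp
  have "cmod (F z - F w) \<le> exp (4 * R\<^sup>2) * 16 ^ Suc n * cmod (z - w)"
    by (rule field_differentiable_bound[of "cball 0 R" F "zeta_fun n"])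
      (use F assms zeta_fun_bound in \<open>auto intro: has_field_derivative_at_within\<close>)
  then show ?thesis unfolding brownian_single int by (simp only: mult_ac diff_diff_eq2 diff_add_cancel)
qed

text \<open>The square of \<open>16 ^ Suc n\<close> is \<open>2 ^ (8 * Suc n)\<close>, and the
  weight at index \<open>n\<close> is \<open>2 ^ Suc n\<close>. So 9 is the least power of the
  weight that leaves a convergent series; its ratio is 1/2 and its sum exactly 1, which keeps the
  constant \<open>C\<close>.\<close>

lemma F_minus_first_order_bound:
  assumes supp: "\<And>\<alpha>. \<alpha> \<notin> range (\<lambda>n. Poly_Mapping.single n 1) \<Longrightarrow> f \<alpha> = 0"
    and bound: "\<And>n. cmod (f (Poly_Mapping.single n 1)) \<le> C * 16 ^ Suc n"
  shows "f \<in> F_minus 9" "norm_minus 9 f \<le> C"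
proof -
  let ?s = "\<lambda>n. Poly_Mapping.single n (1::nat)"
  have C: "C \<ge> 0" using order_trans[OF norm_ge_zero bound[of 0]] by simp
  have inj: "inj ?s"
    by (rule injI) (metis keys_single one_neq_zero singleton_inject)
  have "L2_set (\<lambda>\<alpha>. cmod (f \<alpha>) / sqrt (weight \<alpha> ^ 9)) A \<le> C" if "finite A" for A
  proof -
    let ?g = "\<lambda>\<alpha>. (cmod (f \<alpha>))\<^sup>2 / weight \<alpha> ^ 9"
    \<comment> \<open>As \<open>f\<close> vanishes off the first-order multi-indices, a finite sum
      over \<open>A\<close> becomes one over the finite set \<open>B\<close> of their
      positions.\<close>
    define B where "B = ?s -` A"
    have B: "finite B" unfolding B_def by (rule finite_vimageI[OF that inj])
    have g: "?g (?s n) \<le> C\<^sup>2 * (1/2) ^ Suc n" for n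
    proof -
      have "(cmod (f (?s n)))\<^sup>2 \<le> (C * 16 ^ Suc n)\<^sup>2"
        by (rule power_mono[OF bound]) simp
      also have "\<dots> = C\<^sup>2 * 256 ^ Suc n"
        by (simp add: power_mult_distrib power2_eq_square algebra_simps flip: power_mult_distrib)
      also have "\<dots> = C\<^sup>2 * (1/2) ^ Suc n * (2 ^ 9) ^ Suc n"
        by (simp add: power_mult_distrib[symmetric] del: power_Suc)
      finally have "(cmod (f (?s n)))\<^sup>2 \<le> C\<^sup>2 * (1/2) ^ Suc n * (2 ^ 9) ^ Suc n" .
      moreover have "weight (?s n) ^ 9 = (2 ^ 9) ^ Suc n"
        unfolding power_mult[symmetric] by (simp add: weight_def power_add mult.commute flip: power_mult)
      ultimately show ?thesis by (simp add: pos_divide_le_eq del: power_Suc)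
    qed
    have "sum ?g A = sum ?g (?s ` B)"
      using that supp by (intro sum.mono_neutral_right) (auto simp: B_def)
    also have "\<dots> = (\<Sum>n\<in>B. ?g (?s n))"
      by (simp only: sum.reindex[OF inj_on_subset[OF inj subset_UNIV]] o_def)
    also have "\<dots> \<le> (\<Sum>n\<in>B. C\<^sup>2 * (1/2) ^ Suc n)" by (rule sum_mono) (rule g)
    also have "\<dots> \<le> suminf (\<lambda>n. C\<^sup>2 * (1/2) ^ Suc n)"
      using B power_half_series by (intro sum_le_suminf summable_mult) (auto simp: sums_iff)
    also have "\<dots> = C\<^sup>2"
      using sums_mult[OF power_half_series, of "C\<^sup>2"] by (simp add: sums_iff)
    finally show ?thesis
      unfolding L2_set_def weighted_term[symmetric] using C by (intro real_le_lsqrt) auto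
  qed
  then show "f \<in> F_minus 9" "norm_minus 9 f \<le> C"
    by (blast intro: F_minus_bound)+
qed

lemma brownian_diff_F_minus:
  assumes "cmod z \<le> R" "cmod w \<le> R"
  shows "(\<lambda>\<alpha>. brownian z \<alpha> - brownian w \<alpha>) \<in> F_minus 9"
    and "norm_minus 9 (\<lambda>\<alpha>. brownian z \<alpha> - brownian w \<alpha>) \<le> exp (4 * R\<^sup>2) * cmod (z - w)"
proof -
  have supp: "brownian z \<alpha> - brownian w \<alpha> = 0"
    if "\<alpha> \<notin> range (\<lambda>n. Poly_Mapping.single n 1)" for \<alpha>
    using that by (auto simp: brownian_def)
  show "(\<lambda>\<alpha>. brownian z \<alpha> - brownian w \<alpha>) \<in> F_minus 9"
    "norm_minus 9 (\<lambda>\<alpha>. brownian z \<alpha> - brownian w \<alpha>) \<le> exp (4 * R\<^sup>2) * cmod (z - w)"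
    by (rule F_minus_first_order_bound, erule supp, rule brownian_single_diff[OF assms])+
qed

theorem theorem5p2:
  fixes R :: real
  assumes "R > 0"
  shows "continuous_map (top_of_set (cball (0::complex) R)) F_dist_topology brownian
    \<and> (\<exists>p\<ge>1. (\<forall>z\<in>cball 0 R. brownian z \<in> F_minus p)
        \<and> (\<exists>C. \<forall>z\<in>cball 0 R. norm_minus p (brownian z) \<le> C))"
proof -
  interpret F: Metric_space "F_minus 9" "\<lambda>f g. norm_minus 9 (\<lambda>\<alpha>. f \<alpha> - g \<alpha>)"
    by (rule Metric_space_F_minus)
  let ?K = "exp (4 * R\<^sup>2)"
  \<comment> \<open>The segment from 0 to 0 is degenerate. With \<open>w = 0\<close> the Lipschitz
    estimate thus yields membership and the uniform bound as well.\<close>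
  have zero: "brownian 0 \<alpha> = 0" for \<alpha> by (simp add: brownian_def)
  have mem: "brownian z \<in> F_minus 9" "norm_minus 9 (brownian z) \<le> ?K * R" if "z \<in> cball 0 R" for z
  proof -
    show "brownian z \<in> F_minus 9"
      using brownian_diff_F_minus(1)[of z R 0] that assms by (simp add: zero)
    have "norm_minus 9 (brownian z) \<le> ?K * cmod z"
      using brownian_diff_F_minus(2)[of z R 0] that assms by (simp add: zero)
    also have "\<dots> \<le> ?K * R" using that by simp
    finally show "norm_minus 9 (brownian z) \<le> ?K * R" .
  qed
  \<comment> \<open>Continuity is shown in the single normed space \<open>F_minus 9\<close>, where
    \<open>?K\<close> is a Lipschitz constant, so \<open>e / ?K\<close> serves as the
    radius.\<close>
  have "continuous_map (top_of_set (cball 0 R)) (F_minus_topology 9) brownian"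
    unfolding F_minus_topology_def F.continuous_map_to_metric
  proof (intro ballI allI impI)
    fix z :: complex and e :: real
    assume z: "z \<in> topspace (top_of_set (cball 0 R))" and e: "0 < e"
    show "\<exists>U. openin (top_of_set (cball 0 R)) U \<and> z \<in> U
        \<and> (\<forall>y\<in>U. brownian y \<in> F.mball (brownian z) e)"
    proof (intro exI[of _ "cball 0 R \<inter> ball z (e / ?K)"] conjI ballI)
      fix y assume y: "y \<in> cball 0 R \<inter> ball z (e / ?K)"
      have "norm_minus 9 (\<lambda>\<alpha>. brownian z \<alpha> - brownian y \<alpha>) \<le> ?K * cmod (z - y)"
        using y z by (intro brownian_diff_F_minus(2)) auto
      also have "\<dots> < e" using y by (simp add: dist_norm pos_less_divide_eq mult.commute)
      finally show "brownian y \<in> F.mball (brownian z) e"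
        using y z mem(1) by (simp add: F.mball_def)
    qed (use z e in \<open>auto simp: openin_open\<close>)
  qed
  \<comment> \<open>The inductive limit topology is itself compatible, so the inclusion of
    \<open>F_minus 9\<close> carries continuity over to it.\<close>
  moreover have "continuous_map (F_minus_topology 9) F_dist_topology (\<lambda>f. f)"
    using F_dist_compatible_F_dist_topology by (simp add: F_dist_compatible_def)
  ultimately have "continuous_map (top_of_set (cball 0 R)) F_dist_topology ((\<lambda>f. f) \<circ> brownian)"
    by (rule continuous_map_compose)
  then have "continuous_map (top_of_set (cball 0 R)) F_dist_topology brownian"
    by (simp add: o_def)
  moreover have "\<exists>p\<ge>1. (\<forall>z\<in>cball 0 R. brownian z \<in> F_minus p)
      \<and> (\<exists>C. \<forall>z\<in>cball 0 R. norm_minus p (brownian z) \<le> C)"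
    using mem by (intro exI[of _ 9] exI[of _ "?K * R"] conjI ballI) auto
  ultimately show ?thesis ..
qed

end
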